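(* Let $\mathbf{L}$ be a complete residuated lattice on the real unit interval satisfying $a\rightarrow\bigvee_{i\in I}b_i=\bigvee_{i\in I}(a\rightarrow b_i)$ for all $a\in[0,1]$ and all families $\{b_i\}\subseteq[0,1]$. Then for each theory $\Sigma$, the operator $C_\Sigma:L^{\mathrm{Var}}\to L^{\mathrm{Var}}$ defined by $C_\Sigma(e)=e^\omega_\Sigma$ is a rational $\mathbf{L}$-closure operator.
   Context: A complete residuated lattice on $[0,1]$: $\wedge,\vee$ are min, max, $\langle[0,1],\otimes,1\rangle$ is a commutative monoid and $a\otimes b\le c$ iff $a\le b\rightarrow c$. An $\mathbf{L}$-set in $U$ is a map $U\to[0,1]$; $L^U$ is the set of all of them; finite = finite support; rational = rational values; $A\subseteq B$ pointwise $\le$; unions pointwise suprema; $(c\otimes A)(u)=c\otimes A(u)$; $S(A,B)=\bigwedge_u(A(u)\rightarrow B(u))$. $\mathrm{Var}$ is a denumerable set of propositional variables; a formula is $A\Rightarrow B$ with $A,B$ finite rational $\mathbf{L}$-sets in $\mathrm{Var}$; a theory is a set of formulas. For $e\in L^{\mathrm{Var}}$: $e^0_\Sigma=e$, $e^{n+1}_\Sigma=e^n_\Sigma\cup\bigcup\{S(A,e^n_\Sigma)\otimes B: A\Rightarrow B\in\Sigma\}$, $e^\omega_\Sigma=\bigcup_{n<\omega}e^n_\Sigma$. An $\mathbf{L}$-closure operator on $U$ is $C:L^U\to L^U$ with $A\subseteq C(A)$, $S(A,B)\le S(C(A),C(B))$, $C(C(A))=C(A)$ for all $A,B$; it is rational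 if $C(A)=\bigcup\{C(B):B\sqsubseteq A\}$ for all $A$, where $B\sqsubseteq A$ means $B$ is rational, finite and $B\subseteq A$. *)

theory Defs
  imports Complex_Main "HOL-Library.Countable_Set"
begin

typedef unit_interval = "{0..1::real}"
  morphisms real_of Abs_unit_interval
  by (rule exI[of _ 0]) simp

text \<open>\<open>[0,1]\<close> with its usual order is a complete lattice; \<open>bot\<close> and \<open>top\<close> are 0 and 1. The
  real supremum is unspecified on the empty set and the real infimum likewise, so the
  suprema and infima below adjoin 0 and 1, respectively.\<close>

instantiation unit_interval :: linorder
begin

definition less_eq_unit_interval :: "unit_interval \<Rightarrow> unit_interval \<Rightarrow> bool"
  where "x \<le> y \<longleftrightarrow> real_of x \<le> real_of y"

definition less_unit_interval :: "unit_interval \<Rightarrow> unit_interval \<Rightarrow> bool"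
  where "x < y \<longleftrightarrow> real_of x < real_of y"

instance
  by standard (auto simp: less_eq_unit_interval_def less_unit_interval_def real_of_inject)

end

instantiation unit_interval :: complete_linorder
begin

definition bot_unit_interval :: unit_interval
  where "bot = Abs_unit_interval 0"

definition top_unit_interval :: unit_interval
  where "top = Abs_unit_interval 1"

definition inf_unit_interval :: "unit_interval \<Rightarrow> unit_interval \<Rightarrow> unit_interval"
  where "inf = (min :: unit_interval \<Rightarrow> _)"

definition sup_unit_interval :: "unit_interval \<Rightarrow> unit_interval \<Rightarrow> unit_interval"
  where "sup = (max :: unit_interval \<Rightarrow> _)"

definition Sup_unit_interval :: "unit_interval set \<Rightarrow> unit_interval"
  where "Sup X = Abs_unit_interval (Sup (insert 0 (real_of ` X)))"

definition Inf_unit_interval :: "unit_interval set \<Rightarrow> unit_interval"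
  where "Inf X = Abs_unit_interval (Inf (insert 1 (real_of ` X)))"

instance
proof
  fix x y z :: unit_interval and X :: "unit_interval set"
  have rng: "0 \<le> real_of w \<and> real_of w \<le> 1" for w
    using real_of[of w] by simp
  have bdd: "bdd_above (insert 0 (real_of ` X))" "bdd_below (insert 1 (real_of ` X))"
    using rng by (auto intro!: bdd_aboveI[of _ 1] bdd_belowI[of _ 0])
  have "0 \<le> Sup (insert 0 (real_of ` X))" "Sup (insert 0 (real_of ` X)) \<le> 1"
    using bdd rng by (auto intro!: cSup_upper cSup_least)
  then have Sup: "real_of (Sup X) = Sup (insert 0 (real_of ` X))"
    by (simp add: Sup_unit_interval_def Abs_unit_interval_inverse)
  have "Inf (insert 1 (real_of ` X)) \<le> 1" "0 \<le> Inf (insert 1 (real_of ` X))"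
    using bdd rng by (auto intro!: cInf_lower cInf_greatest)
  then have Inf: "real_of (Inf X) = Inf (insert 1 (real_of ` X))"
    by (simp add: Inf_unit_interval_def Abs_unit_interval_inverse)
  show "inf x y \<le> x" "inf x y \<le> y"
    by (auto simp: inf_unit_interval_def min_def less_eq_unit_interval_def)
  show "x \<le> y \<Longrightarrow> x \<le> z \<Longrightarrow> x \<le> inf y z"
    by (simp add: inf_unit_interval_def min_def)
  show "x \<le> sup x y" "y \<le> sup x y"
    by (auto simp: sup_unit_interval_def max_def less_eq_unit_interval_def)
  show "y \<le> x \<Longrightarrow> z \<le> x \<Longrightarrow> sup y z \<le> x"
    by (simp add: sup_unit_interval_def max_def)
  show "x \<in> X \<Longrightarrow> Inf X \<le> x"
    unfolding less_eq_unit_interval_def Inf using bdd by (intro cInf_lower) auto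
  show "(\<And>w. w \<in> X \<Longrightarrow> z \<le> w) \<Longrightarrow> z \<le> Inf X"
    unfolding less_eq_unit_interval_def Inf using rng by (intro cInf_greatest) auto
  show "x \<in> X \<Longrightarrow> x \<le> Sup X"
    unfolding less_eq_unit_interval_def Sup using bdd by (intro cSup_upper) auto
  show "(\<And>w. w \<in> X \<Longrightarrow> w \<le> z) \<Longrightarrow> Sup X \<le> z"
    unfolding less_eq_unit_interval_def Sup using rng by (intro cSup_least) auto
  show "Inf {} = (top :: unit_interval)"
    by (simp add: Inf_unit_interval_def top_unit_interval_def)
  show "Sup {} = (bot :: unit_interval)"
    by (simp add: Sup_unit_interval_def bot_unit_interval_def)
qed

end

lemma real_of_bot [simp]: "real_of bot = 0"
  and real_of_top [simp]: "real_of top = 1"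
  by (simp_all add: bot_unit_interval_def top_unit_interval_def Abs_unit_interval_inverse)

locale residuated_unit_interval = comm_monoid tensor "top :: unit_interval"
  for tensor :: "unit_interval \<Rightarrow> unit_interval \<Rightarrow> unit_interval" +
  fixes residuum :: "unit_interval \<Rightarrow> unit_interval \<Rightarrow> unit_interval"
  assumes adjointness: "tensor a b \<le> c \<longleftrightarrow> a \<le> residuum b c"

text \<open>The universe of an \<open>L\<close>-set is a type. Inclusion and unions of \<open>L\<close>-sets are the pointwise
  \<open>\<le>\<close>, \<open>sup\<close> and \<open>Sup\<close> on functions.\<close>

type_synonym 'u lset = "'u \<Rightarrow> unit_interval"

definition finite_lset :: "'u lset \<Rightarrow> bool"
  where "finite_lset A \<longleftrightarrow> finite {u. A u \<noteq> bot}"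

definition rational_lset :: "'u lset \<Rightarrow> bool"
  where "rational_lset A \<longleftrightarrow> (\<forall>u. real_of (A u) \<in> \<rat>)"

definition scale :: "(unit_interval \<Rightarrow> unit_interval \<Rightarrow> unit_interval) \<Rightarrow>
    unit_interval \<Rightarrow> 'u lset \<Rightarrow> 'u lset"
  where "scale tensor c A = (\<lambda>u. tensor c (A u))"

definition subsethood :: "(unit_interval \<Rightarrow> unit_interval \<Rightarrow> unit_interval) \<Rightarrow>
    'u lset \<Rightarrow> 'u lset \<Rightarrow> unit_interval"
  where "subsethood residuum A B = (INF u. residuum (A u) (B u))"

definition fin_rat_sub :: "'u lset \<Rightarrow> 'u lset \<Rightarrow> bool"  (infix "\<sqsubseteq>" 50)
  where "B \<sqsubseteq> A \<longleftrightarrow> rational_lset B \<and> finite_lset B \<and> B \<le> A"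

text \<open>The pair \<open>(A, B)\<close> stands for the formula \<open>A \<Rightarrow> B\<close>.\<close>

definition formulas :: "('v lset \<times> 'v lset) set"
  where "formulas = {(A, B). finite_lset A \<and> rational_lset A \<and> finite_lset B \<and> rational_lset B}"

primrec iter :: "(unit_interval \<Rightarrow> unit_interval \<Rightarrow> unit_interval) \<Rightarrow>
    (unit_interval \<Rightarrow> unit_interval \<Rightarrow> unit_interval) \<Rightarrow>
    ('v lset \<times> 'v lset) set \<Rightarrow> 'v lset \<Rightarrow> nat \<Rightarrow> 'v lset"
where
  "iter tensor residuum \<Sigma> e 0 = e"
| "iter tensor residuum \<Sigma> e (Suc n) =
     sup (iter tensor residuum \<Sigma> e n)
       (SUP (A, B)\<in>\<Sigma>. scale tensor (subsethood residuum A (iter tensor residuum \<Sigma> e n)) B)"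

definition theory_closure :: "(unit_interval \<Rightarrow> unit_interval \<Rightarrow> unit_interval) \<Rightarrow>
    (unit_interval \<Rightarrow> unit_interval \<Rightarrow> unit_interval) \<Rightarrow>
    ('v lset \<times> 'v lset) set \<Rightarrow> 'v lset \<Rightarrow> 'v lset"
  where "theory_closure tensor residuum \<Sigma> e = (SUP n. iter tensor residuum \<Sigma> e n)"

definition L_closure_operator :: "(unit_interval \<Rightarrow> unit_interval \<Rightarrow> unit_interval) \<Rightarrow>
    ('u lset \<Rightarrow> 'u lset) \<Rightarrow> bool"
  where "L_closure_operator residuum C \<longleftrightarrow>
    (\<forall>A. A \<le> C A) \<and>
    (\<forall>A B. subsethood residuum A B \<le> subsethood residuum (C A) (C B)) \<and>
    (\<forall>A. C (C A) = C A)"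

definition rational_L_closure_operator :: "(unit_interval \<Rightarrow> unit_interval \<Rightarrow> unit_interval) \<Rightarrow>
    ('u lset \<Rightarrow> 'u lset) \<Rightarrow> bool"
  where "rational_L_closure_operator residuum C \<longleftrightarrow>
    L_closure_operator residuum C \<and> (\<forall>A. C A = (SUP B\<in>{B. B \<sqsubseteq> A}. C B))"

end

theory Submission
  imports Defs
begin

text \<open>
  Call \<open>f\<close> a model of \<open>\<Sigma>\<close> if \<open>S(A, f) \<otimes> B \<subseteq> f\<close> for every \<open>A \<Rightarrow> B\<close> in \<open>\<Sigma>\<close>. Every model
  containing \<open>e\<close> contains the closure of \<open>e\<close>. If \<open>A\<close> has finite support, then \<open>S(A, -)\<close> is an
  infimum of finitely many values, each of which commutes with suprema by assumption; as \<open>[0,1]\<close>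
  is linearly ordered, \<open>S(A, -)\<close> commutes with directed suprema. Hence the closure of \<open>e\<close> is
  itself a model, which gives idempotence, and directed unions of models are models. In
  particular the union of the closures of all \<open>B \<sqsubseteq> A\<close> is a model; it contains \<open>A\<close> because the
  rationals are dense, so it contains the closure of \<open>A\<close>.
\<close>

definition model :: "(unit_interval \<Rightarrow> unit_interval \<Rightarrow> unit_interval) \<Rightarrow>
    (unit_interval \<Rightarrow> unit_interval \<Rightarrow> unit_interval) \<Rightarrow>
    ('v lset \<times> 'v lset) set \<Rightarrow> 'v lset \<Rightarrow> bool"
  where "model tensor residuum \<Sigma> f \<longleftrightarrow>
    (\<forall>(A, B)\<in>\<Sigma>. scale tensor (subsethood residuum A f) B \<le> f)"

text \<open>Induction on \<open>K\<close>: an index serving the new point and one serving the old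
  points have a common upper bound in \<open>D\<close>, to which the upward closed \<open>P\<close>
  passes. This lets a single stage serve a whole finite support.\<close>

lemma finite_subset_directed_bound:
  fixes F :: "'i \<Rightarrow> 'a::order"
  assumes "finite K" "D \<noteq> {}"
    and directed: "\<And>i j. i \<in> D \<Longrightarrow> j \<in> D \<Longrightarrow> \<exists>k\<in>D. F i \<le> F k \<and> F j \<le> F k"
    and mono: "\<And>u x y. x \<le> y \<Longrightarrow> P u x \<Longrightarrow> P u y"
    and "\<And>u. u \<in> K \<Longrightarrow> \<exists>i\<in>D. P u (F i)"
  shows "\<exists>i\<in>D. \<forall>u\<in>K. P u (F i)"
  using assms(1,5)
proof (induction K rule: finite_induct)
  case empty
  then show ?case using assms(2) by blast
next
  case (insert u K)
  then obtain i j where "i \<in> D" "j \<in> D" "P u (F i)" "\<forall>v\<in>K. P v (F j)"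
    by (metis insertCI)
  then show ?case using directed[of i j] mono by (metis insertE)
qed

section \<open>Approximation by finite rational L-sets\<close>

lemma real_of_sup_rational: "real_of (sup a b) \<in> \<rat>" if "real_of a \<in> \<rat>" "real_of b \<in> \<rat>"
  using that by (simp add: sup_unit_interval_def max_def)

lemma unit_interval_rational_between:
  assumes "a < b"
  obtains q where "a < q" "q < b" "real_of q \<in> \<rat>"
proof -
  obtain r where r: "r \<in> \<rat>" "real_of a < r" "r < real_of b"
    using assms Rats_dense_in_real unfolding less_unit_interval_def by blast
  then have "real_of (Abs_unit_interval r) = r"
    using real_of[of a] real_of[of b] by (intro Abs_unit_interval_inverse) auto
  with r that[of "Abs_unit_interval r"] show thesis by (simp add: less_unit_interval_def)
qed

lemma fin_rat_sub_bot: "(\<lambda>_. bot) \<sqsubseteq> A"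
  by (simp add: fin_rat_sub_def rational_lset_def finite_lset_def le_fun_def)

text \<open>This makes the finite rational parts of \<open>A\<close> a directed family.\<close>

lemma fin_rat_sub_sup:
  assumes "B \<sqsubseteq> A" "C \<sqsubseteq> A"
  shows "sup B C \<sqsubseteq> A"
proof -
  have "{u. sup (B u) (C u) \<noteq> bot} \<subseteq> {u. B u \<noteq> bot} \<union> {u. C u \<noteq> bot}"
    by auto
  with assms show ?thesis
    unfolding fin_rat_sub_def finite_lset_def rational_lset_def
    by (auto intro: real_of_sup_rational finite_subset)
qed

text \<open>Singletons suffice: a gap at \<open>u\<close> would contain a rational \<open>q\<close>,
  and the L-set with value \<open>q\<close> at \<open>u\<close> and \<open>bot\<close> elsewhere is
  one of the parts.\<close>

lemma lset_eq_SUP_fin_rat_sub: "A = (SUP B\<in>{B. B \<sqsubseteq> A}. B)"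
proof (rule antisym)
  show "(SUP B\<in>{B. B \<sqsubseteq> A}. B) \<le> A"
    by (rule SUP_least) (simp add: fin_rat_sub_def)
  show "A \<le> (SUP B\<in>{B. B \<sqsubseteq> A}. B)"
  proof (rule le_funI, rule ccontr)
    fix u
    assume "\<not> A u \<le> (SUP B\<in>{B. B \<sqsubseteq> A}. B) u"
    then obtain q where q: "(SUP B\<in>{B. B \<sqsubseteq> A}. B) u < q" "q < A u" "real_of q \<in> \<rat>"
      using unit_interval_rational_between not_le by blast
    define B where "B = (\<lambda>_. bot)(u := q)"
    have "{v. B v \<noteq> bot} \<subseteq> {u}"
      by (auto simp: B_def)
    then have "finite {v. B v \<noteq> bot}"
      by (rule finite_subset) simp
    with q have "B \<sqsubseteq> A"
      by (auto simp: B_def fin_rat_sub_def finite_lset_def rational_lset_def le_fun_def)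
    then have "B \<le> (SUP B\<in>{B. B \<sqsubseteq> A}. B)"
      by (intro SUP_upper) simp
    from le_funD[OF this, of u] have "q \<le> (SUP B\<in>{B. B \<sqsubseteq> A}. B) u"
      by (simp only: B_def fun_upd_same)
    then show False using q(1) by (rule leD[THEN notE])
  qed
qed

section \<open>Algebra of scaling and graded inclusion\<close>

context residuated_unit_interval
begin

lemma tensor_mono: "tensor a b \<le> tensor c d" if "a \<le> c" "b \<le> d"
proof -
  have "tensor a b \<le> tensor c b" if "a \<le> c" for a b c
    using that adjointness order_refl order_trans by metis
  with that show ?thesis by (metis commute order_trans)
qed

lemma residuum_mono: "residuum a b \<le> residuum a c" if "b \<le> c"
  using that adjointness order_refl order_trans by metis

lemma residuum_eq_top_iff: "residuum a b = top \<longleftrightarrow> a \<le> b"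
  using adjointness[of top a b] by (simp add: top_unique)

lemma tensor_SUP_le_iff: "tensor c (SUP i\<in>I. f i) \<le> d \<longleftrightarrow> (\<forall>i\<in>I. tensor c (f i) \<le> d)"
  by (simp add: commute[of c] adjointness SUP_le_iff)

lemma SUP_tensor_le_iff: "tensor (SUP i\<in>I. f i) c \<le> d \<longleftrightarrow> (\<forall>i\<in>I. tensor (f i) c \<le> d)"
  by (simp add: adjointness SUP_le_iff)

text \<open>Adjointness lifted to L-sets: the degree of inclusion is the largest factor that scales
  \<open>A\<close> into \<open>B\<close>.\<close>

lemma le_subsethood_iff: "c \<le> subsethood residuum A B \<longleftrightarrow> scale tensor c A \<le> B"
  by (simp add: subsethood_def le_INF_iff le_fun_def scale_def adjointness)

lemma subsethood_mono: "subsethood residuum A B \<le> subsethood residuum A C" if "B \<le> C"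
  using that le_subsethood_iff order_refl order_trans by metis

lemma top_le_subsethood_iff: "top \<le> subsethood residuum A B \<longleftrightarrow> A \<le> B"
  by (simp add: le_subsethood_iff scale_def)

lemma scale_mono: "scale tensor c A \<le> scale tensor d B" if "c \<le> d" "A \<le> B"
  using that by (simp add: scale_def le_fun_def tensor_mono)

lemma scale_scale: "scale tensor c (scale tensor d A) = scale tensor (tensor c d) A"
  by (simp add: scale_def assoc)

lemma scale_sup_le_iff: "scale tensor c (sup A B) \<le> D \<longleftrightarrow> scale tensor c A \<le> D \<and> scale tensor c B \<le> D"
  by (auto simp: scale_def le_fun_def commute[of c] adjointness)

lemma scale_SUP_le_iff: "scale tensor c (SUP i\<in>I. F i) \<le> D \<longleftrightarrow> (\<forall>i\<in>I. scale tensor c (F i) \<le> D)"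
  by (auto simp: scale_def le_fun_def tensor_SUP_le_iff image_image)

lemma SUP_scale_le_iff: "scale tensor (SUP i\<in>I. c i) A \<le> D \<longleftrightarrow> (\<forall>i\<in>I. scale tensor (c i) A \<le> D)"
  by (auto simp: scale_def le_fun_def SUP_tensor_le_iff)

text \<open>Scaling \<open>A\<close> by its degree of inclusion in \<open>B\<close> lands in
  \<open>B\<close>; scale once more by \<open>c\<close> and use associativity.\<close>

lemma tensor_subsethood_le:
  "tensor c (subsethood residuum A B) \<le> subsethood residuum A (scale tensor c B)"
  using le_subsethood_iff scale_scale scale_mono order_refl by metis

section \<open>The iteration, its limit and graded monotonicity\<close>

lemma iter_mono_nat: "iter tensor residuum \<Sigma> e m \<le> iter tensor residuum \<Sigma> e n" if "m \<le> n"
  using that by (rule lift_Suc_mono_le[rotated]) (simp only: iter.simps sup_ge1)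

lemma iter_le_closure: "iter tensor residuum \<Sigma> e n \<le> theory_closure tensor residuum \<Sigma> e"
  unfolding theory_closure_def by (rule SUP_upper) simp

lemma closure_extensive: "e \<le> theory_closure tensor residuum \<Sigma> e"
  using iter_le_closure[of \<Sigma> e 0] by simp

lemma iter_Suc_ge:
  "scale tensor (subsethood residuum A (iter tensor residuum \<Sigma> e n)) B
    \<le> iter tensor residuum \<Sigma> e (Suc n)" if "(A, B) \<in> \<Sigma>"
  using that unfolding iter.simps by (intro le_supI2 SUP_upper2) auto

text \<open>Induction on the stages: what a formula adds to a stage inside \<open>f\<close> is at
  most what it would add to \<open>f\<close>, and a model already contains that.\<close>

lemma closure_least:
  assumes "e \<le> f" "model tensor residuum \<Sigma> f"
  shows "theory_closure tensor residuum \<Sigma> e \<le> f"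
proof -
  have "iter tensor residuum \<Sigma> e n \<le> f" for n
  proof (induction n)
    case (Suc n)
    have "scale tensor (subsethood residuum A (iter tensor residuum \<Sigma> e n)) B \<le> f"
      if "(A, B) \<in> \<Sigma>" for A B
      using that assms(2) scale_mono[OF subsethood_mono[OF Suc.IH] order_refl, of A B]
      unfolding model_def by (blast intro: order_trans)
    then show ?case
      unfolding iter.simps using Suc.IH by (intro sup_least SUP_least) auto
  qed (simp add: assms(1))
  then show ?thesis unfolding theory_closure_def by (rule SUP_least)
qed

text \<open>Graded monotonicity, stage by stage. The factor \<open>c\<close> moves through each
  formula because c * S(A, e_n) <= S(A, c * e_n) <= S(A, f_n), writing * for \<open>tensor\<close>
  and for scaling. The case of interest is c = S(e, f).\<close>

lemma scale_iter_le:
  assumes "scale tensor c e \<le> f"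
  shows "scale tensor c (iter tensor residuum \<Sigma> e n) \<le> iter tensor residuum \<Sigma> f n"
proof (induction n)
  case (Suc n)
  have "scale tensor c (scale tensor (subsethood residuum A (iter tensor residuum \<Sigma> e n)) B)
      \<le> iter tensor residuum \<Sigma> f (Suc n)" if AB: "(A, B) \<in> \<Sigma>" for A B
  proof -
    have "tensor c (subsethood residuum A (iter tensor residuum \<Sigma> e n))
        \<le> subsethood residuum A (iter tensor residuum \<Sigma> f n)"
      using tensor_subsethood_le subsethood_mono[OF Suc.IH] by (rule order_trans)
    then show ?thesis
      unfolding scale_scale by (rule order_trans[OF scale_mono[OF _ order_refl] iter_Suc_ge[OF AB]])
  qed
  moreover have "scale tensor c (iter tensor residuum \<Sigma> e n) \<le> iter tensor residuum \<Sigma> f (Suc n)"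
    using Suc.IH iter_mono_nat[of n "Suc n"] by (meson le_SucI order_refl order_trans)
  ultimately show ?case
    \<comment> \<open>Only the iteration from \<open>e\<close> is unfolded; the one from
      \<open>f\<close> must stay folded to match the bounds above.\<close>
    by (auto simp only: iter.simps(2)[of _ _ _ e] scale_sup_le_iff scale_SUP_le_iff split: prod.splits)
qed (simp add: assms)

lemma subsethood_closure_le:
  "subsethood residuum e f
    \<le> subsethood residuum (theory_closure tensor residuum \<Sigma> e) (theory_closure tensor residuum \<Sigma> f)"
proof -
  have "scale tensor (subsethood residuum e f) (iter tensor residuum \<Sigma> e n)
      \<le> theory_closure tensor residuum \<Sigma> f" for n
    using scale_iter_le[of "subsethood residuum e f" e f \<Sigma> n] iter_le_closure
    by (meson le_subsethood_iff order_refl order_trans)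
  then show ?thesis
    by (simp add: le_subsethood_iff theory_closure_def[of _ _ _ e] scale_SUP_le_iff)
qed

text \<open>The case of inclusion to degree \<open>top\<close>.\<close>

lemma closure_mono:
  "theory_closure tensor residuum \<Sigma> e \<le> theory_closure tensor residuum \<Sigma> f" if "e \<le> f"
  using that subsethood_closure_le top_le_subsethood_iff order_trans by metis

end

section \<open>Directed suprema, models and rationality\<close>

locale sup_residuated_unit_interval = residuated_unit_interval +
  \<comment> \<open>For empty \<open>X\<close> and \<open>a = bot\<close> the equation would fail:
    the left side is \<open>top\<close>, the right side \<open>bot\<close>.\<close>
  assumes residuum_Sup: "X \<noteq> {} \<Longrightarrow> residuum a (Sup X) = (SUP b\<in>X. residuum a b)"
begin

lemma subsethood_directed_SUP:
  assumes A: "finite_lset A" and "D \<noteq> {}"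
    and directed: "\<And>i j. i \<in> D \<Longrightarrow> j \<in> D \<Longrightarrow> \<exists>k\<in>D. F i \<le> F k \<and> F j \<le> F k"
  shows "subsethood residuum A (SUP i\<in>D. F i) = (SUP i\<in>D. subsethood residuum A (F i))"
proof (rule antisym)
  show "(SUP i\<in>D. subsethood residuum A (F i)) \<le> subsethood residuum A (SUP i\<in>D. F i)"
    by (intro SUP_least subsethood_mono SUP_upper)
  show "subsethood residuum A (SUP i\<in>D. F i) \<le> (SUP i\<in>D. subsethood residuum A (F i))"
  proof (rule ccontr)
    \<comment> \<open>Take \<open>z\<close> to be the right-hand side itself: one index
      \<open>i\<close> with \<open>z\<close> strictly below
      \<open>subsethood residuum A (F i)\<close> is then a contradiction.\<close>
    define z where "z = (SUP i\<in>D. subsethood residuum A (F i))"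
    define K where "K = {u. A u \<noteq> bot}"
    assume "\<not> ?thesis"
    then have z: "z < subsethood residuum A (SUP i\<in>D. F i)"
      by (simp add: z_def not_le)
    have "\<exists>i\<in>D. z < residuum (A u) (F i u)" for u
    proof -
      have "z < residuum (A u) (SUP i\<in>D. F i u)"
        using z by (auto simp: subsethood_def image_image intro: less_le_trans INF_lower)
      also have "\<dots> = (SUP i\<in>D. residuum (A u) (F i u))"
        using \<open>D \<noteq> {}\<close> residuum_Sup[of "(\<lambda>i. F i u) ` D" "A u"] by (simp add: image_image)
      finally show ?thesis by (simp add: less_SUP_iff)
    qed
    moreover have "z < residuum (A u) (y u)" if "x \<le> y" "z < residuum (A u) (x u)" for u x y
      using that(2) residuum_mono[OF le_funD[OF that(1)]] by (rule less_le_trans)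
    moreover have "finite K"
      using A by (simp add: K_def finite_lset_def)
    ultimately have "\<exists>i\<in>D. \<forall>u\<in>K. z < residuum (A u) (F i u)"
      using \<open>D \<noteq> {}\<close> directed
      by (intro finite_subset_directed_bound[where P = "\<lambda>u x. z < residuum (A u) (x u)"])
    then obtain i where i: "i \<in> D" "\<forall>u\<in>K. z < residuum (A u) (F i u)"
      by blast
    \<comment> \<open>Outside the support the antecedent is \<open>bot\<close>, so every index
      serves there.\<close>
    have off_support: "residuum (A u) (F i u) = top" if "u \<notin> K" for u
      using that by (simp add: K_def residuum_eq_top_iff)
    have "z < top"
      using z top_greatest by (rule less_le_trans)
    with i off_support have "z < residuum (A u) (F i u)" for u
      by metis
    \<comment> \<open>Strict bounds need not survive an infinite infimum; here only finitely many
      values occur, so the infimum is attained.\<close>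
    moreover have "finite (range (\<lambda>u. residuum (A u) (F i u)))"
    proof (rule finite_subset)
      show "range (\<lambda>u. residuum (A u) (F i u)) \<subseteq> insert top ((\<lambda>u. residuum (A u) (F i u)) ` K)"
        using off_support by blast
      show "finite (insert top ((\<lambda>u. residuum (A u) (F i u)) ` K))"
        using A by (simp add: K_def finite_lset_def)
    qed
    ultimately have "z < subsethood residuum A (F i)"
      unfolding subsethood_def by (intro finite_imp_less_Inf) auto
    moreover have "subsethood residuum A (F i) \<le> z"
      unfolding z_def using i(1) by (rule SUP_upper)
    ultimately show False by simp
  qed
qed

text \<open>By continuity, a formula applied to the limit is the supremum of its applications to the
  stages, and its application to stage \<open>n\<close> is absorbed by stage
  \<open>Suc n\<close>.\<close>

lemma model_closure:
  assumes "\<Sigma> \<subseteq> formulas"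
  shows "model tensor residuum \<Sigma> (theory_closure tensor residuum \<Sigma> e)"
  unfolding model_def
proof safe
  fix A B
  assume AB: "(A, B) \<in> \<Sigma>"
  with assms have "finite_lset A" by (auto simp: formulas_def)
  then have "subsethood residuum A (theory_closure tensor residuum \<Sigma> e)
      = (SUP n. subsethood residuum A (iter tensor residuum \<Sigma> e n))"
    unfolding theory_closure_def
    by (rule subsethood_directed_SUP) (auto intro: iter_mono_nat max.cobounded1 max.cobounded2)
  then show "scale tensor (subsethood residuum A (theory_closure tensor residuum \<Sigma> e)) B
      \<le> theory_closure tensor residuum \<Sigma> e"
    using order_trans[OF iter_Suc_ge[OF AB] iter_le_closure] by (simp add: SUP_scale_le_iff)
qed

text \<open>The same continuity argument, except that each member absorbs its own formula
  applications.\<close>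

lemma model_directed_SUP:
  assumes "\<Sigma> \<subseteq> formulas" "D \<noteq> {}"
    and directed: "\<And>i j. i \<in> D \<Longrightarrow> j \<in> D \<Longrightarrow> \<exists>k\<in>D. F i \<le> F k \<and> F j \<le> F k"
    and models: "\<And>i. i \<in> D \<Longrightarrow> model tensor residuum \<Sigma> (F i)"
  shows "model tensor residuum \<Sigma> (SUP i\<in>D. F i)"
  unfolding model_def
proof safe
  fix A B
  assume AB: "(A, B) \<in> \<Sigma>"
  with assms have "finite_lset A" by (auto simp: formulas_def)
  then have "subsethood residuum A (SUP i\<in>D. F i) = (SUP i\<in>D. subsethood residuum A (F i))"
    using assms(2) directed by (rule subsethood_directed_SUP)
  moreover have "scale tensor (subsethood residuum A (F i)) B \<le> (SUP i\<in>D. F i)" if "i \<in> D" for i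
    using models[OF that] AB SUP_upper[OF that, of F] unfolding model_def
    by (blast intro: order_trans)
  ultimately show "scale tensor (subsethood residuum A (SUP i\<in>D. F i)) B \<le> (SUP i\<in>D. F i)"
    by (simp add: SUP_scale_le_iff)
qed

lemma closure_eq_SUP_fin_rat_sub:
  assumes "\<Sigma> \<subseteq> formulas"
  shows "theory_closure tensor residuum \<Sigma> A
    = (SUP B\<in>{B. B \<sqsubseteq> A}. theory_closure tensor residuum \<Sigma> B)"
proof (rule antisym)
  let ?C = "theory_closure tensor residuum \<Sigma>"
  show "(SUP B\<in>{B. B \<sqsubseteq> A}. ?C B) \<le> ?C A"
    by (rule SUP_least) (simp add: fin_rat_sub_def closure_mono)
  have "A \<le> (SUP B\<in>{B. B \<sqsubseteq> A}. ?C B)"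
    \<comment> \<open>\<open>A\<close> is the union of its finite rational parts, and each part lies
      in its own closure.\<close>
    using closure_extensive by (subst lset_eq_SUP_fin_rat_sub) (rule SUP_mono, blast)
  moreover have "model tensor residuum \<Sigma> (SUP B\<in>{B. B \<sqsubseteq> A}. ?C B)"
  proof (rule model_directed_SUP[OF assms])
    show "{B. B \<sqsubseteq> A} \<noteq> {}" using fin_rat_sub_bot by blast
    show "\<exists>k\<in>{B. B \<sqsubseteq> A}. ?C i \<le> ?C k \<and> ?C j \<le> ?C k"
      if "i \<in> {B. B \<sqsubseteq> A}" "j \<in> {B. B \<sqsubseteq> A}" for i j
      using that by (intro bexI[of _ "sup i j"]) (auto intro: closure_mono fin_rat_sub_sup)
  qed (rule model_closure[OF assms])
  ultimately show "?C A \<le> (SUP B\<in>{B. B \<sqsubseteq> A}. ?C B)"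
    by (rule closure_least)
qed

lemma closure_idem:
  assumes "\<Sigma> \<subseteq> formulas"
  shows "theory_closure tensor residuum \<Sigma> (theory_closure tensor residuum \<Sigma> e)
    = theory_closure tensor residuum \<Sigma> e"
  using closure_least[OF order_refl model_closure[OF assms]] closure_extensive by (rule antisym)

end

theorem theorem3:
  fixes tensor residuum :: "unit_interval \<Rightarrow> unit_interval \<Rightarrow> unit_interval"
    and \<Sigma> :: "('v lset \<times> 'v lset) set"
  assumes "residuated_unit_interval tensor residuum"
    and "\<And>a X. X \<noteq> {} \<Longrightarrow> residuum a (Sup X) = (SUP b\<in>X. residuum a b)"
    and "countable (UNIV :: 'v set)" and "infinite (UNIV :: 'v set)"
    and "\<Sigma> \<subseteq> formulas"
  shows "rational_L_closure_operator residuum (theory_closure tensor residuum \<Sigma>)"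
proof -
  interpret residuated_unit_interval tensor residuum by (rule assms(1))
  interpret sup_residuated_unit_interval tensor residuum
    by unfold_locales (rule assms(2))
  show ?thesis
    unfolding rational_L_closure_operator_def L_closure_operator_def
    using closure_extensive subsethood_closure_le closure_idem[OF assms(5)]
      closure_eq_SUP_fin_rat_sub[OF assms(5)]
    by blast
qed

end
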